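(* Let $T$ and $S$ be $2$-uniform tolerances on a poset $(P,\le)$ containing no infinite chain. Then $T$ and $S$ permute (i.e. $T\circ S=S\circ T$) if and only if $T$ and $S$ are amicable.
   Context: For a poset $(P,\le)$, $x\prec y$ means that $y$ covers $x$, i.e. $x<y$ and there is no $z$ with $x<z<y$. Suprema and infima, when they exist in $(P,\le)$, are denoted $x\vee y$ and $x\wedge y$. A tolerance on a poset $(P,\le)$ is a reflexive and symmetric binary relation $T$ on $P$ satisfying: (1) if $(x,y),(z,u)\in T$ and $x\vee z$ and $y\vee u$ exist, then $(x\vee z,y\vee u)\in T$; (2) if $(x,y),(z,u)\in T$ and $x\wedge z$ and $y\wedge u$ exist, then $(x\wedge z,y\wedge u)\in T$; (3) if $x,y,z\in P$, $(x,y),(y,z)\in T$ and $T\neq P^2$, then there exist $u,v\in P$ with $u\le x,y,z\le v$ and $(u,y),(y,v)\in T$; (4) if $(x,y)\in T$ and $T\ne P^2$, then there exists $(z,u)\in T$ with $z\le x,y\le u$ such that $(v,z),(v,u)\in T$ for all $v\in P$ with $(v,x),(v,y)\in T$. A block of $T$ is a maximal subset $B\subseteq P$ with $B^2\subseteq T$. The tolerance $T$ is $2$-uniform if every block of $T$ has exactly two elements. The relational product is $T\circ S=\{(a,b)\in P^2:\exists c\in P,\ (a,c)\in T,\ (c,b)\in S\}$. For $a,b\in P$, $a$ is a lower $T$-neighbor of $b$ and $b$ an upper $T$-neighbor of $a$ if $a\prec b$ and $(a,b)\in T$ (similarly for $S$). An element $a$ is a split $(T,S)$-bottom if there exist an upper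 $T$-neighbor $b$ of $a$ and an upper $S$-neighbor of $a$ different from $b$; an adherent $(T,S)$-bottom if some element is both an upper $T$-neighbor and an upper $S$-neighbor of $a$; a $(T,S)$-bottom if it is a split or an adherent $(T,S)$-bottom. Dually: $a$ is a split $(T,S)$-top if there exist a lower $T$-neighbor $b$ of $a$ and a lower $S$-neighbor of $a$ different from $b$; an adherent $(T,S)$-top if some element is both a lower $T$-neighbor and a lower $S$-neighbor of $a$; a $(T,S)$-top if it is either. $T$ and $S$ are amicable if for all $a,b\in P$: (5) if $a\ne b$ and some lower $T$-neighbor of $a$ is a lower $S$-neighbor of $b$, then some upper $S$-neighbor of $a$ is an upper $T$-neighbor of $b$; (6) if $a\ne b$ and some upper $T$-neighbor of $a$ is an upper $S$-neighbor of $b$, then some lower $S$-neighbor of $a$ is a lower $T$-neighbor of $b$; (7) if $a$ is a $(T,S)$-top and $b$ is an upper $T$-neighbor or an upper $S$-neighbor of $a$, then $b$ is a $(T,S)$-top; (8) if $a$ is a $(T,S)$-bottom and $b$ is a lower $T$-neighbor or a lower $S$-neighbor of $a$, then $b$ is a $(T,S)$-bottom. *)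

theory Defs
  imports "HOL-Library.Lub_Glb"
begin

text \<open>The poset is the whole type \<open>'a :: order\<close>, so that \<open>P\<^sup>2\<close> is \<^term>\<open>UNIV :: ('a \<times> 'a) set\<close>.
  Joins and meets are partial: \<open>isLub UNIV {x, y} s\<close> says that \<open>x \<or> y\<close> exists and equals \<open>s\<close>,
  and dually for \<open>isGlb\<close>.\<close>

definition covered_by :: "'a::order \<Rightarrow> 'a \<Rightarrow> bool"  (infix \<open>\<prec>\<close> 50)
  where "x \<prec> y \<longleftrightarrow> x < y \<and> \<not> (\<exists>z. x < z \<and> z < y)"

definition tolerance :: "('a::order \<times> 'a) set \<Rightarrow> bool"
  where "tolerance T \<longleftrightarrow>
    refl T \<and> sym T \<and>
    (\<forall>x y z u s t. (x, y) \<in> T \<and> (z, u) \<in> T \<and> isLub UNIV {x, z} s \<and> isLub UNIV {y, u} t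
        \<longrightarrow> (s, t) \<in> T) \<and>
    (\<forall>x y z u s t. (x, y) \<in> T \<and> (z, u) \<in> T \<and> isGlb UNIV {x, z} s \<and> isGlb UNIV {y, u} t
        \<longrightarrow> (s, t) \<in> T) \<and>
    (\<forall>x y z. (x, y) \<in> T \<and> (y, z) \<in> T \<and> T \<noteq> UNIV
        \<longrightarrow> (\<exists>u v. u \<le> x \<and> u \<le> y \<and> u \<le> z \<and> x \<le> v \<and> y \<le> v \<and> z \<le> v \<and>
                   (u, y) \<in> T \<and> (y, v) \<in> T)) \<and>
    (\<forall>x y. (x, y) \<in> T \<and> T \<noteq> UNIV
        \<longrightarrow> (\<exists>z u. (z, u) \<in> T \<and> z \<le> x \<and> z \<le> y \<and> x \<le> u \<and> y \<le> u \<and>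
                   (\<forall>v. (v, x) \<in> T \<and> (v, y) \<in> T \<longrightarrow> (v, z) \<in> T \<and> (v, u) \<in> T)))"

definition block :: "('a \<times> 'a) set \<Rightarrow> 'a set \<Rightarrow> bool"
  where "block T B \<longleftrightarrow> B \<times> B \<subseteq> T \<and> (\<forall>C. B \<subseteq> C \<and> C \<times> C \<subseteq> T \<longrightarrow> C = B)"

definition two_uniform :: "('a \<times> 'a) set \<Rightarrow> bool"
  where "two_uniform T \<longleftrightarrow> (\<forall>B. block T B \<longrightarrow> card B = 2)"

definition lower_nb :: "('a::order \<times> 'a) set \<Rightarrow> 'a \<Rightarrow> 'a \<Rightarrow> bool"
  where "lower_nb T a b \<longleftrightarrow> a \<prec> b \<and> (a, b) \<in> T"

definition upper_nb :: "('a::order \<times> 'a) set \<Rightarrow> 'a \<Rightarrow> 'a \<Rightarrow> bool"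
  where "upper_nb T b a \<longleftrightarrow> a \<prec> b \<and> (a, b) \<in> T"

definition split_bottom :: "('a::order \<times> 'a) set \<Rightarrow> ('a \<times> 'a) set \<Rightarrow> 'a \<Rightarrow> bool"
  where "split_bottom T S a \<longleftrightarrow> (\<exists>b c. upper_nb T b a \<and> upper_nb S c a \<and> c \<noteq> b)"

definition adherent_bottom :: "('a::order \<times> 'a) set \<Rightarrow> ('a \<times> 'a) set \<Rightarrow> 'a \<Rightarrow> bool"
  where "adherent_bottom T S a \<longleftrightarrow> (\<exists>b. upper_nb T b a \<and> upper_nb S b a)"

definition is_bottom :: "('a::order \<times> 'a) set \<Rightarrow> ('a \<times> 'a) set \<Rightarrow> 'a \<Rightarrow> bool"
  where "is_bottom T S a \<longleftrightarrow> split_bottom T S a \<or> adherent_bottom T S a"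

definition split_top :: "('a::order \<times> 'a) set \<Rightarrow> ('a \<times> 'a) set \<Rightarrow> 'a \<Rightarrow> bool"
  where "split_top T S a \<longleftrightarrow> (\<exists>b c. lower_nb T b a \<and> lower_nb S c a \<and> c \<noteq> b)"

definition adherent_top :: "('a::order \<times> 'a) set \<Rightarrow> ('a \<times> 'a) set \<Rightarrow> 'a \<Rightarrow> bool"
  where "adherent_top T S a \<longleftrightarrow> (\<exists>b. lower_nb T b a \<and> lower_nb S b a)"

definition is_top :: "('a::order \<times> 'a) set \<Rightarrow> ('a \<times> 'a) set \<Rightarrow> 'a \<Rightarrow> bool"
  where "is_top T S a \<longleftrightarrow> split_top T S a \<or> adherent_top T S a"

definition amicable :: "('a::order \<times> 'a) set \<Rightarrow> ('a \<times> 'a) set \<Rightarrow> bool"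
  where "amicable T S \<longleftrightarrow> (\<forall>a b.
    (a \<noteq> b \<and> (\<exists>c. lower_nb T c a \<and> lower_nb S c b)
        \<longrightarrow> (\<exists>d. upper_nb S d a \<and> upper_nb T d b)) \<and>
    (a \<noteq> b \<and> (\<exists>c. upper_nb T c a \<and> upper_nb S c b)
        \<longrightarrow> (\<exists>d. lower_nb S d a \<and> lower_nb T d b)) \<and>
    (is_top T S a \<and> (upper_nb T b a \<or> upper_nb S b a) \<longrightarrow> is_top T S b) \<and>
    (is_bottom T S a \<and> (lower_nb T b a \<or> lower_nb S b a) \<longrightarrow> is_bottom T S b))"

end

theory Submission
  imports Defs
begin

text \<open>In a 2-uniform tolerance \<open>T \<noteq> P\<^sup>2\<close>, conditions (3) and (4) force distinct \<open>T\<close>-related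
  elements to form a covering pair, and every element to have at most one upper and at most one
  lower \<open>T\<close>-neighbor; it has at least one \<open>T\<close>-neighbor since its block has two elements. Thus the graph of \<open>T\<close> is a disjoint union of paths. Compatibility with
  joins and meets enters only through convexity and the exclusion of a four-element crown with two
  parallel \<open>T\<close>-edges.

  If \<open>T\<close> and \<open>S\<close> permute, then a pair \<open>a T c S b\<close> is completed by some \<open>a S d T b\<close>, and all
  positions of \<open>d\<close> but the one required by amicability contradict the covering property or
  produce such a crown.

  Conversely, the only pairs \<open>a T c S b\<close> not settled by (5) and (6) are those with
  \<open>a \<prec> c \<prec> b\<close> or \<open>b \<prec> c \<prec> a\<close>. If no completion \<open>d\<close> exists, then \<open>a\<close>, \<open>c\<close> are neither tops nor
  bottoms, and (6) and (8) propagate this upwards along a chain of neighbors that are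
  alternately \<open>T\<close>- and \<open>S\<close>-related; this chain never ends.

  Reversing the order together with the neighbor relations of both tolerances preserves all of
  these properties of the graphs and exchanges (5) with (6) and (7) with (8).\<close>

section \<open>Amicable neighbor relations\<close>

definition has_both_lower :: "('a \<Rightarrow> 'a \<Rightarrow> bool) \<Rightarrow> ('a \<Rightarrow> 'a \<Rightarrow> bool) \<Rightarrow> 'a \<Rightarrow> bool"
  where "has_both_lower \<tau> \<sigma> a \<longleftrightarrow> (\<exists>x. \<tau> x a) \<and> (\<exists>x. \<sigma> x a)"

definition closes_forks :: "('a \<Rightarrow> 'a \<Rightarrow> bool) \<Rightarrow> ('a \<Rightarrow> 'a \<Rightarrow> bool) \<Rightarrow> bool"
  where "closes_forks \<tau> \<sigma> \<longleftrightarrow>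
    (\<forall>a b. a \<noteq> b \<and> (\<exists>c. \<tau> c a \<and> \<sigma> c b) \<longrightarrow> (\<exists>d. \<sigma> a d \<and> \<tau> b d))"

definition propagates_tops :: "('a \<Rightarrow> 'a \<Rightarrow> bool) \<Rightarrow> ('a \<Rightarrow> 'a \<Rightarrow> bool) \<Rightarrow> bool"
  where "propagates_tops \<tau> \<sigma> \<longleftrightarrow>
    (\<forall>a b. has_both_lower \<tau> \<sigma> a \<and> (\<tau> a b \<or> \<sigma> a b) \<longrightarrow> has_both_lower \<tau> \<sigma> b)"

definition amicable_nb :: "('a \<Rightarrow> 'a \<Rightarrow> bool) \<Rightarrow> ('a \<Rightarrow> 'a \<Rightarrow> bool) \<Rightarrow> bool"
  where "amicable_nb \<tau> \<sigma> \<longleftrightarrow>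
    closes_forks \<tau> \<sigma> \<and> closes_forks \<tau>\<inverse>\<inverse> \<sigma>\<inverse>\<inverse> \<and>
    propagates_tops \<tau> \<sigma> \<and> propagates_tops \<tau>\<inverse>\<inverse> \<sigma>\<inverse>\<inverse>"

lemma closes_forksE:
  assumes "closes_forks \<tau> \<sigma>" "\<tau> c a" "\<sigma> c b" "a \<noteq> b"
  obtains d where "\<sigma> a d" "\<tau> b d"
  using assms unfolding closes_forks_def by blast

lemma propagates_topsD:
  assumes "propagates_tops \<tau> \<sigma>" "has_both_lower \<tau> \<sigma> a" "\<tau> a b \<or> \<sigma> a b"
  shows "has_both_lower \<tau> \<sigma> b"
  using assms unfolding propagates_tops_def by blast

lemma has_both_lower_commute: "has_both_lower \<tau> \<sigma> = has_both_lower \<sigma> \<tau>"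
  by (auto simp: has_both_lower_def)

lemma closes_forks_commute: "closes_forks \<tau> \<sigma> \<longleftrightarrow> closes_forks \<sigma> \<tau>"
proof -
  have "closes_forks \<sigma> \<tau>" if "closes_forks \<tau> \<sigma>" for \<tau> \<sigma> :: "'a \<Rightarrow> 'a \<Rightarrow> bool"
    unfolding closes_forks_def using closes_forksE[OF that] by (metis (no_types))
  then show ?thesis by blast
qed

lemma amicable_nb_commute: "amicable_nb \<tau> \<sigma> \<longleftrightarrow> amicable_nb \<sigma> \<tau>"
  by (auto simp: amicable_nb_def propagates_tops_def
      closes_forks_commute[of \<sigma>] closes_forks_commute[of "\<sigma>\<inverse>\<inverse>"]
      has_both_lower_commute[of \<sigma>] has_both_lower_commute[of "\<sigma>\<inverse>\<inverse>"])

lemma amicable_nb_conversep: "amicable_nb \<tau>\<inverse>\<inverse> \<sigma>\<inverse>\<inverse> \<longleftrightarrow> amicable_nb \<tau> \<sigma>"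
  unfolding amicable_nb_def conversep_conversep by blast

lemma amicable_nb_self:
  assumes "left_unique \<tau>" "right_unique \<tau>"
  shows "amicable_nb \<tau> \<tau>"
  using assms
  by (auto simp: amicable_nb_def closes_forks_def propagates_tops_def has_both_lower_def
      dest: left_uniqueD right_uniqueD)

lemma is_top_eq: "is_top T S = has_both_lower (lower_nb T) (lower_nb S)"
  unfolding fun_eq_iff is_top_def split_top_def adherent_top_def has_both_lower_def by metis

lemma upper_nb_eq: "upper_nb T = (lower_nb T)\<inverse>\<inverse>"
  by (simp add: fun_eq_iff upper_nb_def lower_nb_def)

lemma is_bottom_eq: "is_bottom T S = has_both_lower (lower_nb T)\<inverse>\<inverse> (lower_nb S)\<inverse>\<inverse>"
  unfolding fun_eq_iff is_bottom_def split_bottom_def adherent_bottom_def has_both_lower_def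
    upper_nb_eq by metis

lemma amicable_iff_amicable_nb: "amicable T S \<longleftrightarrow> amicable_nb (lower_nb T) (lower_nb S)"
  unfolding amicable_def amicable_nb_def closes_forks_def propagates_tops_def
    is_top_eq is_bottom_eq upper_nb_eq conversep_iff by (simp only: all_conj_distrib)

section \<open>Covering paths\<close>

definition related :: "('a \<Rightarrow> 'a \<Rightarrow> bool) \<Rightarrow> 'a \<Rightarrow> 'a \<Rightarrow> bool"
  where "related \<tau> x y \<longleftrightarrow> x = y \<or> \<tau> x y \<or> \<tau> y x"

lemma related_conversep: "related \<tau>\<inverse>\<inverse> = related \<tau>"
  by (auto simp: fun_eq_iff related_def)

locale covering_paths =
  fixes less :: "'a \<Rightarrow> 'a \<Rightarrow> bool"  (infix \<open>\<sqsubset>\<close> 50)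
    and nb :: "'a \<Rightarrow> 'a \<Rightarrow> bool"
  assumes asymp_less: "asymp (\<sqsubset>)" and transp_less: "transp (\<sqsubset>)"
    and less_if_nb: "nb x y \<Longrightarrow> x \<sqsubset> y"
    and no_between: "nb x y \<Longrightarrow> x \<sqsubset> z \<Longrightarrow> z \<sqsubset> y \<Longrightarrow> False"
    and left_unique: "left_unique nb" and right_unique: "right_unique nb"
    and ex_related: "\<exists>y. y \<noteq> x \<and> related nb x y"
    and no_crown: "nb x y \<Longrightarrow> nb u v \<Longrightarrow> x \<sqsubset> v \<Longrightarrow> u \<sqsubset> y \<Longrightarrow> y = v"
begin

lemma not_related_if_between: "x \<sqsubset> z \<Longrightarrow> z \<sqsubset> y \<Longrightarrow> \<not> related nb x y"
  using transpD[OF transp_less] asympD[OF asymp_less] less_if_nb no_between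
  unfolding related_def by metis

lemma dual: "covering_paths (\<sqsubset>)\<inverse>\<inverse> nb\<inverse>\<inverse>"
proof unfold_locales
  fix x y u v assume crown: "nb\<inverse>\<inverse> x y" "nb\<inverse>\<inverse> u v" "(\<sqsubset>)\<inverse>\<inverse> x v" "(\<sqsubset>)\<inverse>\<inverse> u y"
  then have "u = x" using no_crown[of v u y x] by simp
  with crown(1,2) show "y = v" using left_uniqueD[OF left_unique] by blast
qed (use asymp_less transp_less less_if_nb no_between left_unique right_unique ex_related
    in \<open>auto simp: related_conversep\<close>)

end

locale covering_paths_pair = T: covering_paths less \<tau> + S: covering_paths less \<sigma>
  for less :: "'a \<Rightarrow> 'a \<Rightarrow> bool"  (infix \<open>\<sqsubset>\<close> 50)
    and \<tau> \<sigma> :: "'a \<Rightarrow> 'a \<Rightarrow> bool"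
begin

lemma pair_swap: "covering_paths_pair (\<sqsubset>) \<sigma> \<tau>"
  by unfold_locales

lemma pair_dual: "covering_paths_pair (\<sqsubset>)\<inverse>\<inverse> \<tau>\<inverse>\<inverse> \<sigma>\<inverse>\<inverse>"
  using T.dual S.dual by (rule covering_paths_pair.intro)

end

section \<open>Permuting relations are amicable\<close>

abbreviation permuting :: "('a \<Rightarrow> 'a \<Rightarrow> bool) \<Rightarrow> ('a \<Rightarrow> 'a \<Rightarrow> bool) \<Rightarrow> bool"
  where "permuting \<tau> \<sigma> \<equiv> related \<tau> OO related \<sigma> = related \<sigma> OO related \<tau>"

context covering_paths_pair
begin

lemma related_path_completion:
  assumes "\<tau> a c" "\<sigma> c b" "related \<sigma> a d" "related \<tau> d b"
  shows "\<sigma> a d \<and> \<tau> d b"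
proof -
  have between: "a \<sqsubset> c" "c \<sqsubset> b" using assms(1,2) T.less_if_nb S.less_if_nb by blast+
  then have ab: "a \<sqsubset> b" using transpD[OF T.transp_less] by blast
  have "d \<noteq> a" "d \<noteq> b"
    using assms(3,4) T.not_related_if_between[OF between] S.not_related_if_between[OF between]
    by blast+
  moreover have "\<not> \<sigma> d a"
    using ab assms(4) S.less_if_nb T.not_related_if_between by blast
  moreover have "\<not> \<tau> b d"
    using ab assms(3) T.less_if_nb S.not_related_if_between by blast
  ultimately show ?thesis using assms(3,4) unfolding related_def by blast
qed

lemma related_fork_completion:
  assumes "\<tau> c a" "\<sigma> c b" "a \<noteq> b" "related \<sigma> a d" "related \<tau> d b"
  shows "\<sigma> a d \<and> \<tau> b d"
proof -
  have less: "c \<sqsubset> a" "c \<sqsubset> b" using assms(1,2) T.less_if_nb S.less_if_nb by blast+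
  then have incomparable: "\<not> a \<sqsubset> b" "\<not> b \<sqsubset> a"
    using assms(1,2) T.no_between S.no_between by blast+
  then have "d \<noteq> a" "d \<noteq> b"
    using assms(3-5) T.less_if_nb S.less_if_nb unfolding related_def by blast+
  moreover have "\<not> (\<sigma> a d \<and> \<tau> d b)" "\<not> (\<sigma> d a \<and> \<tau> b d)"
    using incomparable transpD[OF T.transp_less] T.less_if_nb S.less_if_nb by blast+
  moreover have "\<not> (\<sigma> d a \<and> \<tau> d b)"
    using T.no_crown[OF assms(1) _ less(2)] S.less_if_nb assms(3) by blast
  ultimately show ?thesis using assms(4,5) unfolding related_def by blast
qed

lemma closes_forks_if_permuting:
  assumes "permuting \<tau> \<sigma>"
  shows "closes_forks \<tau> \<sigma>"
  unfolding closes_forks_def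
proof clarify
  fix a b c assume fork: "\<tau> c a" "\<sigma> c b" "a \<noteq> b"
  then have "(related \<tau> OO related \<sigma>) a b" by (auto simp: related_def)
  then obtain d where "related \<sigma> a d" "related \<tau> d b" unfolding assms by (rule relcomppE)
  then show "\<exists>d. \<sigma> a d \<and> \<tau> b d" using related_fork_completion[OF fork] by blast
qed

lemma path_completion_if_permuting:
  assumes "permuting \<tau> \<sigma>" "\<tau> a c" "\<sigma> c b"
  shows "\<exists>d. \<sigma> a d \<and> \<tau> d b"
proof -
  have "(related \<tau> OO related \<sigma>) a b" using assms(2,3) by (auto simp: related_def)
  then obtain d where "related \<sigma> a d" "related \<tau> d b" unfolding assms(1) by (rule relcomppE)
  then show ?thesis using related_path_completion[OF assms(2,3)] by blast
qed

lemma propagates_tops_if_permuting: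
  assumes perm: "permuting \<tau> \<sigma>"
  shows "propagates_tops \<tau> \<sigma>"
  unfolding propagates_tops_def has_both_lower_def
  using path_completion_if_permuting[OF perm]
    covering_paths_pair.path_completion_if_permuting[OF pair_swap perm[symmetric]]
  by blast

lemma amicable_nb_if_permuting:
  assumes perm: "permuting \<tau> \<sigma>"
  shows "amicable_nb \<tau> \<sigma>"
proof -
  interpret dual: covering_paths_pair "(\<sqsubset>)\<inverse>\<inverse>" "\<tau>\<inverse>\<inverse>" "\<sigma>\<inverse>\<inverse>" by (rule pair_dual)
  have dual_perm: "permuting \<tau>\<inverse>\<inverse> \<sigma>\<inverse>\<inverse>"
    unfolding related_conversep by (rule perm)
  show ?thesis
    unfolding amicable_nb_def
    using perm dual_perm closes_forks_if_permuting propagates_tops_if_permuting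
      dual.closes_forks_if_permuting dual.propagates_tops_if_permuting
    by blast
qed

end

section \<open>Amicable relations permute\<close>

text \<open>If \<open>a\<close>, \<open>c\<close>, \<open>b\<close> is an ascending path without completion, then \<open>a\<close>, \<open>c\<close> is such an edge.\<close>

definition alternating_edge :: "('a \<Rightarrow> 'a \<Rightarrow> bool) \<Rightarrow> ('a \<Rightarrow> 'a \<Rightarrow> bool) \<Rightarrow> 'a \<Rightarrow> 'a \<Rightarrow> bool"
  where "alternating_edge \<tau> \<sigma> x y \<longleftrightarrow>
    \<tau> x y \<and> (\<nexists>z. \<sigma> x z) \<and> (\<nexists>z. \<sigma> z y) \<and> (\<nexists>z. \<tau> y z)"

context covering_paths_pair
begin

lemma alternating_edge_extend:
  assumes "amicable_nb \<tau> \<sigma>" "alternating_edge \<tau> \<sigma> x y"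
  obtains z where "y \<sqsubset> z" "alternating_edge \<sigma> \<tau> y z"
proof -
  have forks: "closes_forks \<tau>\<inverse>\<inverse> \<sigma>\<inverse>\<inverse>" and bottoms: "propagates_tops \<tau>\<inverse>\<inverse> \<sigma>\<inverse>\<inverse>"
    using assms(1) unfolding amicable_nb_def by blast+
  have edge: "\<tau> x y" "\<nexists>z. \<sigma> x z" "\<nexists>z. \<sigma> z y" "\<nexists>z. \<tau> y z"
    using assms(2) unfolding alternating_edge_def by blast+
  then obtain z where z: "\<sigma> y z" using S.ex_related[of y] unfolding related_def by blast
  have no_lower: "\<nexists>w. \<tau> w z"
  proof
    assume "\<exists>w. \<tau> w z"
    then obtain w where w: "\<tau> w z" by blast
    then have "w \<noteq> y" using edge(4) by blast
    then obtain d where "\<sigma> d w" "\<tau> d y" using closes_forksE[OF forks, of z w y] w z by blast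
    then show False using left_uniqueD[OF T.left_unique] edge(1,2) by blast
  qed
  have "\<nexists>w. \<sigma> z w"
  proof
    assume "\<exists>w. \<sigma> z w"
    then have "has_both_lower \<tau>\<inverse>\<inverse> \<sigma>\<inverse>\<inverse> z"
      using T.ex_related[of z] no_lower by (auto simp: has_both_lower_def related_def)
    then have "has_both_lower \<tau>\<inverse>\<inverse> \<sigma>\<inverse>\<inverse> y" using propagates_topsD[OF bottoms] z by blast
    then show False using edge(4) by (auto simp: has_both_lower_def)
  qed
  then have "alternating_edge \<sigma> \<tau> y z"
    using z no_lower edge(4) unfolding alternating_edge_def by blast
  with S.less_if_nb[OF z] show ?thesis by (rule that)
qed

lemma no_alternating_edge:
  assumes "wfp (\<sqsubset>)\<inverse>\<inverse>" "amicable_nb \<tau> \<sigma>"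
  shows "\<not> alternating_edge \<tau> \<sigma> x y"
proof -
  interpret swap: covering_paths_pair "(\<sqsubset>)" \<sigma> \<tau> by (rule pair_swap)
  have amicable: "amicable_nb \<sigma> \<tau>" using assms(2) by (simp add: amicable_nb_commute)
  from assms(1) have "\<not> alternating_edge \<tau> \<sigma> x y \<and> \<not> alternating_edge \<sigma> \<tau> x y"
  proof (induction y arbitrary: x rule: wfp_induct_rule)
    case (less y)
    have False if "alternating_edge \<tau> \<sigma> x y"
      using alternating_edge_extend[OF assms(2) that] less.IH by blast
    moreover have False if "alternating_edge \<sigma> \<tau> x y"
      using swap.alternating_edge_extend[OF amicable that] less.IH by blast
    ultimately show ?case by blast
  qed
  then show ?thesis ..
qed

lemma path_completion_from_upper_nb:
  assumes "closes_forks \<tau> \<sigma>" "\<tau> a c" "\<sigma> c b" "\<sigma> a d" "c \<noteq> d"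
  shows "\<tau> d b"
proof -
  obtain e where "\<sigma> c e" "\<tau> d e" using closes_forksE[OF assms(1,2,4,5)] .
  then show ?thesis using right_uniqueD[OF S.right_unique assms(3)] by blast
qed

lemma path_completion_if_middle_upper_nb:
  assumes "amicable_nb \<tau> \<sigma>" "\<tau> a c" "\<sigma> c b" "\<tau> c e"
  shows "\<exists>d. \<sigma> a d \<and> \<tau> d b"
proof -
  interpret reversed: covering_paths_pair "(\<sqsubset>)\<inverse>\<inverse>" "\<sigma>\<inverse>\<inverse>" "\<tau>\<inverse>\<inverse>"
    by (rule covering_paths_pair.pair_dual[OF pair_swap])
  have forks: "closes_forks \<tau> \<sigma>" "closes_forks \<sigma>\<inverse>\<inverse> \<tau>\<inverse>\<inverse>"
    and tops: "propagates_tops \<tau> \<sigma>" and bottoms: "propagates_tops \<tau>\<inverse>\<inverse> \<sigma>\<inverse>\<inverse>"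
    using assms(1) amicable_nb_commute[of \<tau> \<sigma>] unfolding amicable_nb_def by blast+
  have "has_both_lower \<tau>\<inverse>\<inverse> \<sigma>\<inverse>\<inverse> c" using assms(3,4) by (auto simp: has_both_lower_def)
  then have "has_both_lower \<tau>\<inverse>\<inverse> \<sigma>\<inverse>\<inverse> a" using propagates_topsD[OF bottoms] assms(2) by blast
  then obtain d where d: "\<sigma> a d" by (auto simp: has_both_lower_def)
  show ?thesis
  proof (cases "d = c")
    case False
    then show ?thesis using path_completion_from_upper_nb[OF forks(1) assms(2,3) d] d by blast
  next
    case True
    then have "has_both_lower \<tau> \<sigma> c" using assms(2) d by (auto simp: has_both_lower_def)
    then have "has_both_lower \<tau> \<sigma> b" using propagates_topsD[OF tops] assms(3) by blast
    then obtain h where h: "\<tau> h b" by (auto simp: has_both_lower_def)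
    show ?thesis
    proof (cases "h = c")
      case True
      then show ?thesis using \<open>d = c\<close> d h by blast
    next
      case False
      then show ?thesis
        using reversed.path_completion_from_upper_nb[OF forks(2), of b c a h] assms h by auto
    qed
  qed
qed

lemma path_completion_if_amicable:
  assumes "wfp (\<sqsubset>)\<inverse>\<inverse>" "amicable_nb \<tau> \<sigma>" "\<tau> a c" "\<sigma> c b"
  shows "\<exists>d. \<sigma> a d \<and> \<tau> d b"
proof -
  interpret reversed: covering_paths_pair "(\<sqsubset>)\<inverse>\<inverse>" "\<sigma>\<inverse>\<inverse>" "\<tau>\<inverse>\<inverse>"
    by (rule covering_paths_pair.pair_dual[OF pair_swap])
  have reversed_amicable: "amicable_nb \<sigma>\<inverse>\<inverse> \<tau>\<inverse>\<inverse>"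
    using assms(2) amicable_nb_commute amicable_nb_conversep by metis
  consider (upper) e where "\<tau> c e" | (lower) e where "\<sigma> e c"
    | (neither) "\<nexists>e. \<tau> c e" "\<nexists>e. \<sigma> e c" by blast
  then show ?thesis
  proof cases
    case upper
    then show ?thesis using path_completion_if_middle_upper_nb[OF assms(2-4)] by blast
  next
    case lower
    then show ?thesis
      using reversed.path_completion_if_middle_upper_nb[OF reversed_amicable, of b c a e] assms(3,4) by auto
  next
    case neither
    then obtain d where "\<sigma> a d"
      using no_alternating_edge[OF assms(1,2), of a c] assms(3) unfolding alternating_edge_def by blast
    moreover have "c \<noteq> d" using neither(2) \<open>\<sigma> a d\<close> by blast
    moreover have "closes_forks \<tau> \<sigma>" using assms(2) by (simp add: amicable_nb_def)
    ultimately show ?thesis using path_completion_from_upper_nb assms(3,4) by blast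
  qed
qed

lemma relcompp_subset_if_amicable:
  assumes "wfp (\<sqsubset>)\<inverse>\<inverse>" "amicable_nb \<tau> \<sigma>"
  shows "related \<tau> OO related \<sigma> \<le> related \<sigma> OO related \<tau>"
proof (rule predicate2I, elim relcomppE)
  interpret swap: covering_paths_pair "(\<sqsubset>)" \<sigma> \<tau> by (rule pair_swap)
  have forks: "closes_forks \<tau> \<sigma>" "closes_forks \<tau>\<inverse>\<inverse> \<sigma>\<inverse>\<inverse>"
    using assms(2) unfolding amicable_nb_def by blast+
  fix a b c assume ac: "related \<tau> a c" and cb: "related \<sigma> c b"
  have "\<exists>d. related \<sigma> a d \<and> related \<tau> d b"
  proof (cases "a = b \<or> a = c \<or> c = b")
    case True
    then show ?thesis using ac cb by (auto simp: related_def)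
  next
    case False
    then consider (ascending) "\<tau> a c" "\<sigma> c b" | (meeting) "\<tau> a c" "\<sigma> b c"
      | (forking) "\<tau> c a" "\<sigma> c b" | (descending) "\<sigma> b c" "\<tau> c a"
      using ac cb unfolding related_def by blast
    then have "\<exists>d. (\<sigma> a d \<or> \<sigma> d a) \<and> (\<tau> d b \<or> \<tau> b d)"
    proof cases
      case ascending
      then show ?thesis using path_completion_if_amicable[OF assms] by blast
    next
      case meeting
      then show ?thesis using closes_forksE[OF forks(2), of c a b] False by blast
    next
      case forking
      then show ?thesis using closes_forksE[OF forks(1), of c a b] False by blast
    next
      case descending
      then show ?thesis
        using swap.path_completion_if_amicable[OF assms(1)] assms(2) amicable_nb_commute by blast
    qed
    then show ?thesis unfolding related_def by blast
  qed
  then show "(related \<sigma> OO related \<tau>) a b" by blast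
qed

lemma permuting_iff_amicable_nb:
  assumes "wfp (\<sqsubset>)\<inverse>\<inverse>"
  shows "permuting \<tau> \<sigma> \<longleftrightarrow> amicable_nb \<tau> \<sigma>"
proof
  interpret swap: covering_paths_pair "(\<sqsubset>)" \<sigma> \<tau> by (rule pair_swap)
  assume "amicable_nb \<tau> \<sigma>"
  then show "permuting \<tau> \<sigma>"
    using assms relcompp_subset_if_amicable swap.relcompp_subset_if_amicable amicable_nb_commute
    by (blast intro: order.antisym)
qed (rule amicable_nb_if_permuting)

end

section \<open>Tolerances with two-element blocks\<close>

lemma lower_nb_less: "lower_nb T x y \<Longrightarrow> x < y"
  by (simp add: lower_nb_def covered_by_def)

lemma lower_nb_rel: "lower_nb T x y \<Longrightarrow> (x, y) \<in> T"
  by (simp add: lower_nb_def)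

lemma lower_nb_no_between: "lower_nb T x y \<Longrightarrow> x < z \<Longrightarrow> z < y \<Longrightarrow> False"
  by (auto simp: lower_nb_def covered_by_def)

lemma tolerance_refl: "tolerance T \<Longrightarrow> (x, x) \<in> T"
  unfolding tolerance_def by (elim conjE) (rule refl_onD[OF _ UNIV_I])

lemma tolerance_sym: "tolerance T \<Longrightarrow> (x, y) \<in> T \<Longrightarrow> (y, x) \<in> T"
  unfolding tolerance_def by (elim conjE) (rule symD)

lemma tolerance_join:
  assumes "tolerance T" "(x, y) \<in> T" "(z, u) \<in> T" "isLub UNIV {x, z} s" "isLub UNIV {y, u} t"
  shows "(s, t) \<in> T"
  using assms unfolding tolerance_def by (elim conjE) blast

lemma tolerance_meet:
  assumes "tolerance T" "(x, y) \<in> T" "(z, u) \<in> T" "isGlb UNIV {x, z} s" "isGlb UNIV {y, u} t"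
  shows "(s, t) \<in> T"
  using assms unfolding tolerance_def by (elim conjE) blast

lemma tolerance_bounds:
  assumes "tolerance T" "T \<noteq> UNIV" "(x, y) \<in> T" "(y, z) \<in> T"
  obtains u v where "u \<le> x" "u \<le> z" "x \<le> v" "z \<le> v" "(u, y) \<in> T" "(y, v) \<in> T"
proof -
  have "\<forall>x y z. (x, y) \<in> T \<and> (y, z) \<in> T \<and> T \<noteq> UNIV
      \<longrightarrow> (\<exists>u v. u \<le> x \<and> u \<le> y \<and> u \<le> z \<and> x \<le> v \<and> y \<le> v \<and> z \<le> v \<and> (u, y) \<in> T \<and> (y, v) \<in> T)"
    using assms(1) unfolding tolerance_def by (elim conjE)
  then show ?thesis using assms(2-4) that by blast
qed

lemma tolerance_lower_extension:
  assumes "tolerance T" "T \<noteq> UNIV" "(x, y) \<in> T"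
  obtains z where "z \<le> x" "z \<le> y" "\<And>v. (v, x) \<in> T \<Longrightarrow> (v, y) \<in> T \<Longrightarrow> (v, z) \<in> T"
proof -
  have "\<forall>x y. (x, y) \<in> T \<and> T \<noteq> UNIV
      \<longrightarrow> (\<exists>z u. (z, u) \<in> T \<and> z \<le> x \<and> z \<le> y \<and> x \<le> u \<and> y \<le> u \<and>
             (\<forall>v. (v, x) \<in> T \<and> (v, y) \<in> T \<longrightarrow> (v, z) \<in> T \<and> (v, u) \<in> T))"
    using assms(1) unfolding tolerance_def by (elim conjE)
  then show ?thesis using assms(2,3) that by blast
qed

lemma tolerance_crossing:
  fixes T :: "('a::order \<times> 'a) set"
  assumes tol: "tolerance T" and "(x, y) \<in> T" "(u, v) \<in> T" "x \<le> v" "u \<le> y"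
  shows "(v, y) \<in> T" "(x, u) \<in> T"
proof -
  have vu: "(v, u) \<in> T" using tol assms(3) by (rule tolerance_sym)
  have "isLub UNIV {x, v} v" "isLub UNIV {y, u} y"
    using assms(4,5) by (auto simp: isLub_def leastP_def isUb_def setle_def setge_def)
  then show "(v, y) \<in> T" by (rule tolerance_join[OF tol assms(2) vu])
  have "isGlb UNIV {x, v} x" "isGlb UNIV {y, u} u"
    using assms(4,5) by (auto simp: isGlb_def greatestP_def isLb_def setle_def setge_def)
  then show "(x, u) \<in> T" by (rule tolerance_meet[OF tol assms(2) vu])
qed

lemma tolerance_convex:
  assumes "tolerance T" "(x, y) \<in> T" "x \<le> w" "w \<le> y"
  shows "(x, w) \<in> T" "(w, y) \<in> T"
  using tolerance_crossing[OF assms(1,2) tolerance_refl] assms by blast+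

lemma ex_block_containing:
  assumes "A \<times> A \<subseteq> T"
  obtains B where "block T B" "A \<subseteq> B"
proof -
  let ?F = "{C. A \<subseteq> C \<and> C \<times> C \<subseteq> T}"
  have "\<exists>B\<in>?F. \<forall>C\<in>?F. B \<subseteq> C \<longrightarrow> C = B"
  proof (rule subset_Zorn_nonempty)
    show "?F \<noteq> {}" using assms by blast
  next
    fix K assume K: "K \<noteq> {}" "subset.chain ?F K"
    then have members: "K \<subseteq> ?F" by (simp add: subset_chain_def)
    have "(x, y) \<in> T" if "x \<in> \<Union>K" "y \<in> \<Union>K" for x y
    proof -
      have "{x, y} \<subseteq> \<Union>K" using that by blast
      then obtain C where "C \<in> K" "{x, y} \<subseteq> C"
        using finite_subset_Union_chain[of "{x, y}" K ?F] K by blast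
      then show ?thesis using members by blast
    qed
    then show "\<Union>K \<in> ?F" using K(1) members by blast
  qed
  then obtain B where B: "A \<subseteq> B" "B \<times> B \<subseteq> T"
    and maximal: "\<And>C. A \<subseteq> C \<Longrightarrow> C \<times> C \<subseteq> T \<Longrightarrow> B \<subseteq> C \<Longrightarrow> C = B"
    by simp metis
  have "block T B" using B maximal unfolding block_def by (meson order.trans)
  then show ?thesis using B(1) by (rule that)
qed

lemma two_uniform_card_le:
  assumes "two_uniform T" "A \<times> A \<subseteq> T"
  shows "card A \<le> 2"
proof -
  obtain B where "block T B" "A \<subseteq> B" using assms(2) by (rule ex_block_containing)
  moreover from this have "card B = 2" using assms(1) by (simp add: two_uniform_def)
  moreover from this have "finite B" using card.infinite by fastforce
  ultimately show ?thesis using card_mono[of B A] by simp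
qed

lemma two_uniform_no_triangle:
  assumes "tolerance T" "two_uniform T" "(x, y) \<in> T" "(y, z) \<in> T" "(x, z) \<in> T"
  shows "x = y \<or> y = z \<or> x = z"
proof (rule ccontr)
  assume "\<not> ?thesis"
  then have "card {x, y, z} = 3" by simp
  moreover have "{x, y, z} \<times> {x, y, z} \<subseteq> T"
    using assms tolerance_refl[OF assms(1)] tolerance_sym[OF assms(1)] by auto
  ultimately show False using two_uniform_card_le[OF assms(2), of "{x, y, z}"] by simp
qed

lemma two_uniform_ex_related:
  assumes "tolerance T" "two_uniform T"
  obtains y where "y \<noteq> x" "(x, y) \<in> T"
proof -
  have "{x} \<times> {x} \<subseteq> T" using tolerance_refl[OF assms(1)] by blast
  then obtain B where B: "block T B" "{x} \<subseteq> B" by (rule ex_block_containing)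
  then have "card B = 2" using assms(2) by (simp add: two_uniform_def)
  then obtain y where "y \<in> B" "y \<noteq> x" by (metis card_2_iff')
  moreover have "B \<times> B \<subseteq> T" using B(1) by (simp add: block_def)
  ultimately show ?thesis using that B(2) by blast
qed

lemma two_uniform_interval:
  assumes "tolerance T" "two_uniform T" "(x, y) \<in> T" "x \<le> w" "w \<le> y"
  shows "w = x \<or> w = y"
  using two_uniform_no_triangle[OF assms(1,2) tolerance_convex[OF assms(1,3-5)] assms(3)] assms(4,5)
  by auto

lemma two_uniform_lower_nbI:
  assumes "tolerance T" "two_uniform T" "(x, y) \<in> T" "x < y"
  shows "lower_nb T x y"
  using two_uniform_interval[OF assms(1-3)] assms(3,4)
  unfolding lower_nb_def covered_by_def by (auto simp: less_le)

lemma two_uniform_unique_on_side: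
  assumes "tolerance T" "two_uniform T" "(x, y) \<in> T" "(y, z) \<in> T"
    and side: "x < y \<and> z < y \<or> y < x \<and> y < z"
  shows "x = z"
proof (cases "T = UNIV")
  case True
  then show ?thesis using two_uniform_no_triangle[OF assms(1-4)] side by auto
next
  case False
  then obtain u v where u: "u \<le> x" "u \<le> z" "(u, y) \<in> T" and v: "x \<le> v" "z \<le> v" "(y, v) \<in> T"
    using assms(3,4) by (rule tolerance_bounds[OF assms(1)])
  note interval = two_uniform_interval[OF assms(1,2)]
  from side show ?thesis
  proof
    assume "x < y \<and> z < y"
    then have "x = u" "z = u"
      using interval[OF u(3), of x] interval[OF u(3), of z] u(1,2) by (auto simp: less_imp_le)
    then show ?thesis by simp
  next
    assume "y < x \<and> y < z"
    then have "x = v" "z = v"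
      using interval[OF v(3), of x] interval[OF v(3), of z] v(1,2) by (auto simp: less_imp_le)
    then show ?thesis by simp
  qed
qed

lemma two_uniform_lower_nb_unique:
  assumes "tolerance T" "two_uniform T"
  shows "left_unique (lower_nb T)" "right_unique (lower_nb T)"
proof -
  note unique = two_uniform_unique_on_side[OF assms]
  show "left_unique (lower_nb T)"
  proof (rule left_uniqueI)
    fix x y z assume nb: "lower_nb T x y" "lower_nb T z y"
    then have "(x, y) \<in> T" "(y, z) \<in> T" using lower_nb_rel tolerance_sym[OF assms(1)] by blast+
    then show "x = z" by (rule unique) (simp add: nb[THEN lower_nb_less])
  qed
  show "right_unique (lower_nb T)"
  proof (rule right_uniqueI)
    fix x y z assume nb: "lower_nb T y x" "lower_nb T y z"
    then have "(x, y) \<in> T" "(y, z) \<in> T" using lower_nb_rel tolerance_sym[OF assms(1)] by blast+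
    then show "x = z" by (rule unique) (simp add: nb[THEN lower_nb_less])
  qed
qed

lemma two_uniform_comparable:
  assumes "tolerance T" "two_uniform T" "T \<noteq> UNIV" "(x, y) \<in> T"
  shows "x \<le> y \<or> y \<le> x"
proof -
  obtain z where z: "z \<le> x" "z \<le> y"
    and extends: "\<And>v. (v, x) \<in> T \<Longrightarrow> (v, y) \<in> T \<Longrightarrow> (v, z) \<in> T"
    using tolerance_lower_extension[OF assms(1,3,4)] by blast
  have "(x, z) \<in> T" "(y, z) \<in> T"
    using extends assms(4) tolerance_refl[OF assms(1)] tolerance_sym[OF assms(1)] by blast+
  then show ?thesis using two_uniform_no_triangle[OF assms(1,2,4)] z by blast
qed

lemma related_lower_nb:
  assumes "tolerance T" "two_uniform T" "T \<noteq> UNIV"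
  shows "related (lower_nb T) = (\<lambda>x y. (x, y) \<in> T)"
proof (intro ext iffI)
  fix x y assume "related (lower_nb T) x y"
  then show "(x, y) \<in> T"
    using tolerance_refl[OF assms(1)] tolerance_sym[OF assms(1)] lower_nb_rel
    unfolding related_def by blast
next
  fix x y assume xy: "(x, y) \<in> T"
  then have "x = y \<or> x < y \<or> y < x" using two_uniform_comparable[OF assms] by (auto simp: less_le)
  then show "related (lower_nb T) x y"
    using two_uniform_lower_nbI[OF assms(1,2)] xy tolerance_sym[OF assms(1) xy]
    unfolding related_def by blast
qed

lemma covering_paths_lower_nb:
  assumes "tolerance T" "two_uniform T" "T \<noteq> UNIV"
  shows "covering_paths (<) (lower_nb T)"
proof unfold_locales
  show "\<exists>y. y \<noteq> x \<and> related (lower_nb T) x y" for x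
    unfolding related_lower_nb[OF assms] using two_uniform_ex_related[OF assms(1,2), of x] by blast
  fix x y u v assume crown: "lower_nb T x y" "lower_nb T u v" "x < v" "u < y"
  then have "(v, y) \<in> T"
    using tolerance_crossing(1)[OF assms(1), of x y u v] by (simp add: lower_nb_def)
  then have "v \<le> y \<or> y \<le> v" by (rule two_uniform_comparable[OF assms])
  then show "y = v" using crown lower_nb_no_between by (metis order.not_eq_order_implies_strict)
qed (use two_uniform_lower_nb_unique[OF assms(1,2)] lower_nb_less lower_nb_no_between in auto)

lemma two_uniform_UNIV_unique:
  assumes "two_uniform (UNIV :: ('a \<times> 'a) set)" "two_uniform (S :: ('a \<times> 'a) set)"
  shows "S = UNIV"
proof -
  have card: "card (UNIV :: 'a set) = 2"
    using assms(1) unfolding two_uniform_def block_def by auto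
  then have finite: "finite (UNIV :: 'a set)" using card.infinite by fastforce
  obtain B where B: "block S B" by (rule ex_block_containing[of "{}" S]) auto
  then have "card B = card (UNIV :: 'a set)" using assms(2) card by (simp add: two_uniform_def)
  then have "B = UNIV" using card_subset_eq[OF finite subset_UNIV] by blast
  then show ?thesis using B unfolding block_def by auto
qed

lemma wfp_greater_if_no_infinite_chain:
  assumes "\<not> (\<exists>C::'a::order set. Complete_Partial_Order.chain (\<le>) C \<and> infinite C)"
  shows "wfp ((<) :: 'a \<Rightarrow> 'a \<Rightarrow> bool)\<inverse>\<inverse>"
proof (rule ccontr)
  assume "\<not> ?thesis"
  then obtain f :: "nat \<Rightarrow> 'a" where "\<And>i. f i < f (Suc i)"
    unfolding wf_iff_no_infinite_down_chain[to_pred] by blast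
  then have f: "strict_mono f" by (simp add: strict_mono_Suc_iff)
  then have "infinite (range f)" by (simp add: finite_image_iff strict_mono_imp_inj_on)
  moreover have "Complete_Partial_Order.chain (\<le>) (range f)"
    unfolding Complete_Partial_Order.chain_def
    using strict_mono_less_eq[OF f] nat_le_linear by blast
  ultimately show False using assms by blast
qed

theorem theorem3p3:
  fixes T S :: "('a::order \<times> 'a) set"
  assumes "tolerance T" and "two_uniform T"
    and "tolerance S" and "two_uniform S"
    and "\<not> (\<exists>C::'a set. Complete_Partial_Order.chain (\<le>) C \<and> infinite C)"
  shows "T O S = S O T \<longleftrightarrow> amicable T S"
proof (cases "T = UNIV \<or> S = UNIV")
  case True
  then have "T = S" using assms(2,4) two_uniform_UNIV_unique by blast
  then show ?thesis
    unfolding amicable_iff_amicable_nb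
    using amicable_nb_self two_uniform_lower_nb_unique[OF assms(1,2)] by blast
next
  case False
  then interpret covering_paths_pair "(<)" "lower_nb T" "lower_nb S"
    using assms(1-4) by (intro covering_paths_pair.intro covering_paths_lower_nb) auto
  have "T O S = S O T \<longleftrightarrow> permuting (lower_nb T) (lower_nb S)"
    using assms(1-4) False by (simp add: related_lower_nb relcompp_relcomp_eq pred_equals_eq2)
  also have "\<dots> \<longleftrightarrow> amicable T S"
    unfolding amicable_iff_amicable_nb
    using wfp_greater_if_no_infinite_chain[OF assms(5)] by (rule permuting_iff_amicable_nb)
  finally show ?thesis .
qed

end
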